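(* Let $\mathbf{A}\in\mathbb{R}^{n\times m}$, $\mathbf{y}\in\mathbb{N}^n$, $\bm{\mu}_0\in\mathbb{R}^m$ and $\mathbf{C}_0\in\mathcal{S}_m^+$ be fixed. For $\mathbf{\bar x}\in\mathbb{R}^m$ and $\mathbf{C}\in\mathcal{S}_m^+$ let $q(\mathbf{x})=\mathcal{N}(\mathbf{x};\mathbf{\bar x},\mathbf{C})$ and $$F(\mathbf{\bar x},\mathbf{C})=\int_{\mathbb{R}^m} q(\mathbf{x})\ln\frac{p(\mathbf{x},\mathbf{y})}{q(\mathbf{x})}\,\mathrm{d}\mathbf{x},$$ where $$p(\mathbf{x},\mathbf{y}) = (2\pi)^{-\frac{m}{2}}|\mathbf{C}_0|^{-\frac{1}{2}} e^{(\mathbf{A}\mathbf{x},\mathbf{y})-(e^{\mathbf{A}\mathbf{x}},\mathbf{1}_n)-(\ln(\mathbf{y}!),\mathbf{1}_n)-\frac{1}{2}(\mathbf{x}-\bm{\mu}_0)^t\mathbf{C}^{-1}_0(\mathbf{x}-\bm{\mu}_0)}.$$ Then $$F(\mathbf{\bar{x}},\mathbf{C}) = (\mathbf{y},\mathbf{A}\mathbf{\bar{x}})- (\mathbf{1}_n,e^{\mathbf{A}\mathbf{\bar{x}}+\frac{1}{2}\mathrm{diag}(\mathbf{A}\mathbf{C}\mathbf{A}^t)}) - \tfrac{1}{2}(\mathbf{\bar{x}}-\bm{\mu}_0)^t\mathbf{C}^{-1}_0(\mathbf{\bar{x}}-\bm{\mu}_0) - \tfrac{1}{2}\mathrm{tr}(\mathbf{C}^{-1}_0\mathbf{C})+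 \tfrac{1}{2}\ln|\mathbf{C}| - \tfrac{1}{2}\ln|\mathbf{C}_0| + \tfrac{m}{2} - (\mathbf{1}_n,\ln(\mathbf{y}!)).$$
   Context: $\mathbb{N}=\{0,1,2,\ldots\}$. $\mathcal{S}_m^+$ is the set of real symmetric positive definite $m\times m$ matrices, $|\cdot|$ is the determinant, the superscript $t$ denotes transpose, and $(\cdot,\cdot)$ is the Euclidean inner product. $\mathbf{1}_n\in\mathbb{R}^n$ is the all-ones vector. Exponential, logarithm and factorial of a vector are taken componentwise. For a square matrix $\mathbf{M}$, $\mathrm{diag}(\mathbf{M})$ is the vector of its diagonal entries. $\mathcal{N}(\mathbf{x};\mathbf{\bar x},\mathbf{C})=(2\pi)^{-m/2}|\mathbf{C}|^{-1/2}e^{-\frac12(\mathbf{x}-\mathbf{\bar x})^t\mathbf{C}^{-1}(\mathbf{x}-\mathbf{\bar x})}$ is the Gaussian density. *)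

theory Defs
  imports "HOL-Analysis.Analysis"
begin

definition spd_matrices :: "(real^'m^'m) set" where
  "spd_matrices = {C. transpose C = C \<and> (\<forall>x. x \<noteq> 0 \<longrightarrow> x \<bullet> (C *v x) > 0)}"

definition vec_exp :: "real^'n \<Rightarrow> real^'n" where
  "vec_exp v = (\<chi> i. exp (v $ i))"

definition vec_ln :: "real^'n \<Rightarrow> real^'n" where
  "vec_ln v = (\<chi> i. ln (v $ i))"

definition vec_fact :: "nat^'n \<Rightarrow> real^'n" where
  "vec_fact y = (\<chi> i. fact (y $ i))"

definition vec_real :: "nat^'n \<Rightarrow> real^'n" where
  "vec_real y = (\<chi> i. real (y $ i))"

definition diag_vec :: "real^'n^'n \<Rightarrow> real^'n" where
  "diag_vec M = (\<chi> i. M $ i $ i)"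

definition gaussian_density :: "real^'m \<Rightarrow> real^'m^'m \<Rightarrow> real^'m \<Rightarrow> real" where
  "gaussian_density xbar C x =
     (2 * pi) powr (- (real CARD('m) / 2)) * det C powr (- (1/2))
     * exp (- (1/2) * ((x - xbar) \<bullet> (matrix_inv C *v (x - xbar))))"

(* The vector 1 :: real^'n is the all-ones vector (the multiplication on this type is
   componentwise), so inner products with it are sums of components. *)

definition joint_density ::
    "real^'m^'n \<Rightarrow> real^'m \<Rightarrow> real^'m^'m \<Rightarrow> real^'m \<Rightarrow> nat^'n \<Rightarrow> real" where
  "joint_density A \<mu>0 C0 x y =
     (2 * pi) powr (- (real CARD('m) / 2)) * det C0 powr (- (1/2))
     * exp ((A *v x) \<bullet> vec_real y - vec_exp (A *v x) \<bullet> 1 - vec_ln (vec_fact y) \<bullet> 1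
            - (1/2) * ((x - \<mu>0) \<bullet> (matrix_inv C0 *v (x - \<mu>0))))"

definition F_integrand ::
    "real^'m^'n \<Rightarrow> nat^'n \<Rightarrow> real^'m \<Rightarrow> real^'m^'m \<Rightarrow> real^'m \<Rightarrow> real^'m^'m \<Rightarrow> real^'m \<Rightarrow> real" where
  "F_integrand A y \<mu>0 C0 xbar C x =
     gaussian_density xbar C x
     * ln (joint_density A \<mu>0 C0 x y / gaussian_density xbar C x)"

definition F_functional ::
    "real^'m^'n \<Rightarrow> nat^'n \<Rightarrow> real^'m \<Rightarrow> real^'m^'m \<Rightarrow> real^'m \<Rightarrow> real^'m^'m \<Rightarrow> real" where
  "F_functional A y \<mu>0 C0 xbar C = (LINT x|lborel. F_integrand A y \<mu>0 C0 xbar C x)"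

end

theory Submission
  imports Defs "HOL-Probability.Distributions"
begin

text \<open>
  Factor $C = L L^t$ with $L$ invertible. Substituting $x = \bar x + L z$ turns $q(x)\,dx$ into the
  standard Gaussian measure in $z$, a product of one-dimensional ones. The logarithm
  $\ln (p/q)$ is a sum of a quadratic polynomial and exponentials of affine functions, so only
  the moments $E\,1 = 1$, $E\,z_i = 0$, $E\,z_i z_j = \delta_{ij}$ and
  $E\,e^{(b,z)} = e^{|b|^2/2}$ are needed; for the latter, $b$ is a row of $A L$, and
  $|b|^2$ is the corresponding diagonal entry of $A C A^t$.
\<close>

section \<open>Lebesgue measure on vectors as a product measure\<close>

lemma prod_Basis_vec: "(\<Prod>b\<in>(Basis :: (real^'n) set). g b) = (\<Prod>i\<in>UNIV. g (axis i 1))"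
proof -
  have "bij_betw (\<lambda>i. axis i 1) UNIV (Basis :: (real^'n) set)"
    by (auto simp: bij_betw_def inj_on_def axis_eq_axis Basis_vec_def)
  from prod.reindex_bij_betw[OF this] show ?thesis ..
qed

lemma borel_measurable_vec_lambda_PiM [measurable]:
  "(\<lambda>f. (\<chi> i. f i) :: real^'n) \<in> borel_measurable (Pi\<^sub>M UNIV (\<lambda>_::'n. lborel))"
  by (subst borel_measurable_euclidean_space) (auto simp: Basis_vec_def inner_axis)

text \<open>Lebesgue measure is determined by its values on boxes, and the preimage of a box under
  the vector constructor is a product of intervals. This carries Fubini for
  \<open>Pi\<^sub>M\<close> over to \<open>real^'n\<close>.\<close>

lemma lborel_vec_eq:
  "(lborel :: (real^'n) measure) = distr (Pi\<^sub>M UNIV (\<lambda>_. lborel)) borel (\<lambda>f. \<chi> i. f i)"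
    (is "_ = distr ?P _ ?v")
proof (rule lborel_eqI)
  interpret product_sigma_finite "\<lambda>_::'n. lborel :: real measure" ..
  fix l u :: "real^'n" assume le: "\<And>b. b \<in> Basis \<Longrightarrow> l \<bullet> b \<le> u \<bullet> b"
  then have le': "l $ i \<le> u $ i" for i
    using axis_in_Basis_iff[of i "1::real"] by (fastforce simp: inner_axis)
  have "emeasure (distr ?P borel ?v) (box l u) = emeasure ?P (?v -` box l u \<inter> space ?P)"
    by (subst emeasure_distr) auto
  also have "?v -` box l u \<inter> space ?P = (\<Pi>\<^sub>E i\<in>UNIV. {l $ i <..< u $ i})"
    by (auto simp: mem_box_cart space_PiM PiE_iff)
  also have "emeasure ?P \<dots> = (\<Prod>i\<in>UNIV. emeasure lborel {l $ i <..< u $ i})"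
    by (subst emeasure_PiM) auto
  also have "\<dots> = (\<Prod>i\<in>UNIV. ennreal (u $ i - l $ i))"
    using le' by simp
  also have "\<dots> = ennreal (\<Prod>b\<in>Basis. (u - l) \<bullet> b)"
    using le' by (simp add: prod_Basis_vec inner_axis prod_ennreal)
  finally show "emeasure (distr ?P borel ?v) (box l u) = ennreal (\<Prod>b\<in>Basis. (u - l) \<bullet> b)" .
qed simp

text \<open>Fubini for functions with separated variables. It reduces every Gaussian moment below to
  moments on the real line.\<close>

lemma has_bochner_integral_lborel_vec_prod:
  fixes f :: "'n::finite \<Rightarrow> real \<Rightarrow> real"
  assumes "\<And>i. has_bochner_integral lborel (f i) (I i)"
  shows "has_bochner_integral lborel (\<lambda>x::real^'n. \<Prod>i\<in>UNIV. f i (x $ i)) (\<Prod>i\<in>UNIV. I i)"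
proof -
  interpret product_sigma_finite "\<lambda>_::'n. lborel :: real measure" ..
  have int: "integrable lborel (f i)" and I: "integral\<^sup>L lborel (f i) = I i" for i
    using assms[of i] by (simp_all add: has_bochner_integral_iff)
  have [measurable]: "f i \<in> borel_measurable borel" for i
    using borel_measurable_integrable[OF int] by simp
  have "has_bochner_integral (Pi\<^sub>M UNIV (\<lambda>_. lborel)) (\<lambda>x. \<Prod>i\<in>UNIV. f i (x i)) (\<Prod>i\<in>UNIV. I i)"
    using product_integrable_prod[of UNIV f] product_integral_prod[of UNIV f] int I
    by (simp add: has_bochner_integral_iff)
  then show ?thesis
    by (subst lborel_vec_eq, intro has_bochner_integral_distr) simp_all
qed

section \<open>Invertible linear substitutions in Lebesgue integrals\<close>

text \<open>With all coordinates other than \<open>m\<close> held fixed, the shear translates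
  coordinate \<open>m\<close> by the constant \<open>x $ n\<close>, so the claim follows from
  translation invariance on the line.\<close>

lemma nn_integral_lborel_shear:
  fixes f :: "real^'n \<Rightarrow> ennreal"
  assumes [measurable]: "f \<in> borel_measurable borel" and "m \<noteq> n"
  shows "(\<integral>\<^sup>+x. f (x + (x $ n) *\<^sub>R axis m 1) \<partial>lborel) = (\<integral>\<^sup>+x. f x \<partial>lborel)"
proof -
  interpret product_sigma_finite "\<lambda>_::'n. lborel :: real measure" ..
  let ?v = "\<lambda>f. (\<chi> i. f i) :: real^'n"
  let ?I = "UNIV - {m}"
  have U: "insert m ?I = UNIV" by auto
  have m1: "(\<lambda>h. f (?v h + (?v h $ n) *\<^sub>R axis m 1)) \<in> borel_measurable (Pi\<^sub>M UNIV (\<lambda>_. lborel))"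
    by (intro measurable_compose[OF _ assms(1)] borel_measurable_add borel_measurable_scaleR) simp_all
  have m2: "(\<lambda>h. f (?v h)) \<in> borel_measurable (Pi\<^sub>M UNIV (\<lambda>_. lborel))"
    by measurable
  have mx: "(\<lambda>y. f (?v (x(m := y)))) \<in> borel_measurable borel" for x
  proof -
    have "(\<lambda>y. ?v (x(m := y))) = (\<lambda>y. ?v (x(m := 0)) + y *\<^sub>R axis m 1)"
      by (auto simp: vec_eq_iff axis_def)
    then have "(\<lambda>y. ?v (x(m := y))) \<in> borel_measurable borel"
      by simp
    from measurable_compose[OF this assms(1)] show ?thesis by simp
  qed
  have "(\<integral>\<^sup>+x. f (x + (x $ n) *\<^sub>R axis m 1) \<partial>lborel)
      = (\<integral>\<^sup>+h. f (?v h + (?v h $ n) *\<^sub>R axis m 1) \<partial>(Pi\<^sub>M UNIV (\<lambda>_. lborel)))"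
    by (subst lborel_vec_eq, subst nn_integral_distr) (auto, measurable)
  also have "\<dots> = (\<integral>\<^sup>+x. \<integral>\<^sup>+y. f (?v (x(m := y)) + (?v (x(m := y)) $ n) *\<^sub>R axis m 1) \<partial>lborel \<partial>Pi\<^sub>M ?I (\<lambda>_. lborel))"
    using product_nn_integral_insert[of ?I m, unfolded U, OF _ _ m1] by simp
  \<comment> \<open>Updating coordinate \<open>m\<close> leaves \<open>x n\<close> unchanged because
    \<open>m\<close> and \<open>n\<close> differ. The factor \<open>1 *\<close> fits the shape of
    \<open>nn_integral_real_affine\<close>.\<close>
  also have "\<dots> = (\<integral>\<^sup>+x. \<integral>\<^sup>+y. f (?v (x(m := x n + 1 * y))) \<partial>lborel \<partial>Pi\<^sub>M ?I (\<lambda>_. lborel))"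
    using \<open>m \<noteq> n\<close> by (intro nn_integral_cong arg_cong[where f=f]) (auto simp: vec_eq_iff axis_def)
  also have "\<dots> = (\<integral>\<^sup>+x. \<integral>\<^sup>+y. f (?v (x(m := y))) \<partial>lborel \<partial>Pi\<^sub>M ?I (\<lambda>_. lborel))"
  proof (rule nn_integral_cong)
    fix x :: "'n \<Rightarrow> real"
    show "(\<integral>\<^sup>+y. f (?v (x(m := x n + 1 * y))) \<partial>lborel) = (\<integral>\<^sup>+y. f (?v (x(m := y))) \<partial>lborel)"
      using nn_integral_real_affine[OF mx[of x], of 1 "x n"] by simp
  qed
  also have "\<dots> = (\<integral>\<^sup>+h. f (?v h) \<partial>(Pi\<^sub>M UNIV (\<lambda>_. lborel)))"
    using product_nn_integral_insert[of ?I m, unfolded U, OF _ _ m2] by simp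
  also have "\<dots> = (\<integral>\<^sup>+x. f x \<partial>lborel)"
    by (subst lborel_vec_eq, subst nn_integral_distr) (auto, measurable)
  finally show ?thesis .
qed

lemma borel_measurable_matrix_vector_mult [measurable]:
  "(*v) (A :: real^'m^'n) \<in> borel_measurable borel"
  by (intro borel_measurable_continuous_onI matrix_vector_mult_linear_continuous_on)

text \<open>The change of variables theorems of \<^theory>\<open>HOL-Analysis.Change_Of_Vars\<close> need a well-ordered
  index type; decomposing into elementary matrices avoids this restriction.\<close>

lemma nn_integral_lborel_linear:
  fixes f :: "real^'n \<Rightarrow> ennreal" and A :: "real^'n^'n"
  assumes "f \<in> borel_measurable borel" and "det A \<noteq> 0"
  shows "ennreal \<bar>det A\<bar> * (\<integral>\<^sup>+x. f (A *v x) \<partial>lborel) = (\<integral>\<^sup>+x. f x \<partial>lborel)"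
proof -
  \<comment> \<open>The function \<open>f\<close> is quantified inside \<open>?P\<close> because the
    product case uses the hypothesis for \<open>B\<close> at the composition of \<open>f\<close>
    with \<open>A\<close>. The determinant condition sits there too, as the induction also runs
    through singular matrices.\<close>
  let ?P = "\<lambda>A::real^'n^'n. det A \<noteq> 0 \<longrightarrow> (\<forall>f \<in> borel_measurable borel.
    ennreal \<bar>det A\<bar> * (\<integral>\<^sup>+x. f (A *v x) \<partial>lborel) = (\<integral>\<^sup>+x. f x \<partial>lborel))"
  have "?P A"
  proof (rule induct_matrix_elementary_alt[of ?P])
    fix A B :: "real^'n^'n"
    assume P: "?P A" "?P B"
    show "?P (A ** B)"
    proof (intro impI ballI)
      fix f :: "real^'n \<Rightarrow> ennreal"
      assume nz: "det (A ** B) \<noteq> 0" and [measurable]: "f \<in> borel_measurable borel"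
      have "ennreal \<bar>det (A ** B)\<bar> * (\<integral>\<^sup>+x. f ((A ** B) *v x) \<partial>lborel)
          = ennreal \<bar>det A\<bar> * (ennreal \<bar>det B\<bar> * (\<integral>\<^sup>+x. f (A *v (B *v x)) \<partial>lborel))"
        by (simp add: det_mul abs_mult ennreal_mult mult.assoc matrix_vector_mul_assoc)
      also have "ennreal \<bar>det B\<bar> * (\<integral>\<^sup>+x. f (A *v (B *v x)) \<partial>lborel) = (\<integral>\<^sup>+x. f (A *v x) \<partial>lborel)"
        using P(2)[rule_format, of "\<lambda>x. f (A *v x)"] nz by (simp add: det_mul)
      also have "ennreal \<bar>det A\<bar> * \<dots> = (\<integral>\<^sup>+x. f x \<partial>lborel)"
        using P(1) nz by (simp add: det_mul)
      finally show "ennreal \<bar>det (A ** B)\<bar> * (\<integral>\<^sup>+x. f ((A ** B) *v x) \<partial>lborel) = (\<integral>\<^sup>+x. f x \<partial>lborel)" .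
    qed
  next
    fix A :: "real^'n^'n" and i
    assume "row i A = 0"
    then show "?P A"
      by (simp add: det_zero_row)
  next
    fix A :: "real^'n^'n"
    assume diag: "\<And>i j. i \<noteq> j \<Longrightarrow> A $ i $ j = 0"
    show "?P A"
    proof (intro impI ballI)
      fix f :: "real^'n \<Rightarrow> ennreal"
      assume nz: "det A \<noteq> 0" and [measurable]: "f \<in> borel_measurable borel"
      have dA: "det A = (\<Prod>i\<in>UNIV. A $ i $ i)"
        by (rule det_diagonal[OF diag])
      \<comment> \<open>\<open>?c\<close> recovers the diagonal entry belonging to a basis vector,
        which carries no index itself. \<open>?T\<close> is multiplication by \<open>A\<close> in
        the form that \<open>lborel_affine_euclidean\<close> expects, with translation 0.\<close>
      let ?c = "\<lambda>b::real^'n. b \<bullet> (A *v b)"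
      have c: "?c (axis i 1) = A $ i $ i" for i
        by (simp add: inner_axis' matrix_vector_mult_basis column_def)
      let ?T = "\<lambda>x. 0 + (\<Sum>j\<in>Basis. (?c j * (x \<bullet> j)) *\<^sub>R j)"
      have Av: "(A *v x) $ i = A $ i $ i * x $ i" for x i
      proof -
        have "(A *v x) $ i = (\<Sum>j\<in>UNIV. if j = i then A $ i $ i * x $ i else 0)"
          unfolding matrix_vector_mult_def vec_lambda_beta by (intro sum.cong) (auto simp: diag)
        then show ?thesis by simp
      qed
      have T: "?T = (*v) A"
      proof
        fix x
        have "A *v x = (\<Sum>j\<in>Basis. ((A *v x) \<bullet> j) *\<^sub>R j)"
          by (simp add: euclidean_representation)
        also have "\<dots> = ?T x"
          by (auto simp: Basis_vec_def c inner_axis Av intro!: sum.cong)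
        finally show "?T x = A *v x" ..
      qed
      have "lborel = density (distr lborel borel ?T) (\<lambda>_. (\<Prod>j\<in>Basis. \<bar>?c j\<bar>))"
        using nz by (intro lborel_affine_euclidean) (auto simp: Basis_vec_def c dA)
      also have "(\<Prod>j\<in>Basis. \<bar>?c j\<bar>) = \<bar>det A\<bar>"
        by (simp add: prod_Basis_vec c dA abs_prod)
      finally have eq: "lborel = density (distr lborel borel ((*v) A)) (\<lambda>_. ennreal \<bar>det A\<bar>)"
        unfolding T .
      show "ennreal \<bar>det A\<bar> * (\<integral>\<^sup>+x. f (A *v x) \<partial>lborel) = (\<integral>\<^sup>+x. f x \<partial>lborel)"
        by (subst (2) eq) (simp add: nn_integral_density nn_integral_distr nn_integral_cmult)
    qed
  next
    fix m n :: 'n assume "m \<noteq> n"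
    let ?t = "Transposition.transpose m n"
    let ?A = "\<chi> i j. mat 1 $ i $ ?t j :: real^'n^'n"
    have tt: "?t permutes UNIV"
      by (rule permutes_swap_id) auto
    have Av: "(?A *v x) $ i = x $ ?t i" for x i
    proof -
      have "(?A *v x) $ i = (\<Sum>j\<in>UNIV. if j = ?t i then x $ ?t i else 0)"
        unfolding matrix_vector_mult_def vec_lambda_beta
        by (intro sum.cong) (auto simp: mat_def)
      then show ?thesis by simp
    qed
    have d: "\<bar>det ?A\<bar> = 1"
      by (simp add: det_permute_columns[OF tt] sign_def)
    \<comment> \<open>Swapping two coordinates permutes the side lengths of a box and hence keeps
      its volume; since the swap is an involution, the preimage of a box is the box with swapped
      corners.\<close>
    have eq: "lborel = distr lborel borel ((*v) ?A)"
    proof (rule lborel_eqI)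
      fix l u :: "real^'n" assume le: "\<And>b. b \<in> Basis \<Longrightarrow> l \<bullet> b \<le> u \<bullet> b"
      then have le': "l $ i \<le> u $ i" for i
        using axis_in_Basis_iff[of i "1::real"] by (fastforce simp: inner_axis)
      have "(*v) ?A -` box l u = box (\<chi> i. l $ ?t i) (\<chi> i. u $ ?t i)"
        by (auto simp: mem_box_cart Av) (metis transpose_involutory)+
      then have "emeasure (distr lborel borel ((*v) ?A)) (box l u)
          = emeasure lborel (box (\<chi> i. l $ ?t i) (\<chi> i. u $ ?t i))"
        by (simp add: emeasure_distr)
      also have "\<dots> = ennreal (\<Prod>i\<in>UNIV. u $ ?t i - l $ ?t i)"
        using le'
        by (subst emeasure_lborel_box) (auto simp: inner_axis prod_Basis_vec dest!: axis_inverse)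
      also have "(\<Prod>i\<in>UNIV. u $ ?t i - l $ ?t i) = (\<Prod>i\<in>UNIV. u $ i - l $ i)"
        by (rule prod.permute[OF tt, unfolded o_def, symmetric])
      finally show "emeasure (distr lborel borel ((*v) ?A)) (box l u) = ennreal (\<Prod>b\<in>Basis. (u - l) \<bullet> b)"
        by (simp add: prod_Basis_vec inner_axis)
    qed simp
    show "?P ?A"
    proof (intro impI ballI)
      fix f :: "real^'n \<Rightarrow> ennreal"
      assume [measurable]: "f \<in> borel_measurable borel"
      show "ennreal \<bar>det ?A\<bar> * (\<integral>\<^sup>+x. f (?A *v x) \<partial>lborel) = (\<integral>\<^sup>+x. f x \<partial>lborel)"
        unfolding d by (subst (2) eq) (simp add: nn_integral_distr)
    qed
  next
    fix m n :: 'n assume "m \<noteq> n"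
    let ?A = "\<chi> i j. of_bool (i = m \<and> j = n \<or> i = j) :: real^'n^'n"
    \<comment> \<open>The shear matrix arises from the identity by adding row \<open>n\<close> to
      row \<open>m\<close>, which keeps the determinant.\<close>
    have "?A = (\<chi> k. if k = m then row m (mat 1) + 1 *s row n (mat 1) else row k (mat 1))"
      using \<open>m \<noteq> n\<close> by (auto simp: vec_eq_iff row_def mat_def)
    then have d: "det ?A = 1"
      using det_row_operation[OF \<open>m \<noteq> n\<close>, of "mat 1 :: real^'n^'n" 1] det_I by metis
    have Av: "?A *v x = x + (x $ n) *\<^sub>R axis m 1" for x
    proof -
      have "(?A *v x) $ i = (\<Sum>j\<in>UNIV. (if j = i then x $ i else 0) + (if j = n then of_bool (i = m) * x $ n else 0))" for i
        unfolding matrix_vector_mult_def vec_lambda_beta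
        using \<open>m \<noteq> n\<close> by (intro sum.cong) auto
      then show ?thesis
        by (simp add: vec_eq_iff sum.distrib axis_def)
    qed
    show "?P ?A"
      unfolding d Av using nn_integral_lborel_shear \<open>m \<noteq> n\<close> by auto
  qed
  with assms show ?thesis by blast
qed

text \<open>Testing on indicator functions reduces this to the linear substitution, and translation
  invariance absorbs \<open>a\<close>. As an equation between measures it applies to Bochner
  integrals as well.\<close>

lemma lborel_affine_vec:
  fixes L :: "real^'n^'n"
  assumes "det L \<noteq> 0"
  shows "lborel = density (distr lborel borel (\<lambda>z. a + L *v z)) (\<lambda>_. ennreal \<bar>det L\<bar>)"
proof (rule measure_eqI)
  fix X :: "(real^'n) set" assume "X \<in> sets lborel"
  then have [measurable]: "X \<in> sets borel" by simp
  have "emeasure (density (distr lborel borel (\<lambda>z. a + L *v z)) (\<lambda>_. ennreal \<bar>det L\<bar>)) X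
      = ennreal \<bar>det L\<bar> * (\<integral>\<^sup>+z. indicator X (a + L *v z) \<partial>lborel)"
    by (simp add: emeasure_density nn_integral_cmult nn_integral_distr del: nn_integral_indicator)
  also have "\<dots> = (\<integral>\<^sup>+x. indicator X (a + x) \<partial>lborel)"
    using assms by (intro nn_integral_lborel_linear) simp_all
  also have "\<dots> = (\<integral>\<^sup>+x. indicator X x \<partial>distr lborel borel ((+) a))"
    by (simp add: nn_integral_distr del: nn_integral_indicator)
  also have "\<dots> = emeasure lborel X"
    by (simp add: lborel_distr_plus)
  finally show "emeasure lborel X =
      emeasure (density (distr lborel borel (\<lambda>z. a + L *v z)) (\<lambda>_. ennreal \<bar>det L\<bar>)) X" ..
qed simp

lemma has_bochner_integral_lborel_affine_vec:
  fixes L :: "real^'n^'n" and f :: "real^'n \<Rightarrow> real"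
  assumes "det L \<noteq> 0" and [measurable]: "f \<in> borel_measurable borel"
    and "has_bochner_integral lborel (\<lambda>z. \<bar>det L\<bar> * f (a + L *v z)) I"
  shows "has_bochner_integral lborel f I"
proof -
  have "has_bochner_integral (distr lborel borel (\<lambda>z. a + L *v z)) (\<lambda>x. \<bar>det L\<bar> *\<^sub>R f x) I"
    using assms(3) by (intro has_bochner_integral_distr) simp_all
  then have "has_bochner_integral (density (distr lborel borel (\<lambda>z. a + L *v z)) (\<lambda>_. ennreal \<bar>det L\<bar>)) f I"
    by (intro has_bochner_integral_density) simp_all
  then show ?thesis
    using lborel_affine_vec[OF assms(1), of a] by simp
qed

section \<open>Factorization of positive definite matrices\<close>

lemma inner_matrix_vector_transpose:
  fixes D :: "real^'n^'m"
  shows "x \<bullet> (D *v y) = (transpose D *v x) \<bullet> y"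
  by (simp add: dot_lmul_matrix)

text \<open>Gram--Schmidt for the inner product $x^t C y$.\<close>

lemma spd_orthonormal_subset:
  fixes C :: "real^'m^'m"
  assumes "C \<in> spd_matrices" and "k \<le> CARD('m)"
  shows "\<exists>B. finite B \<and> card B = k \<and> (\<forall>b\<in>B. \<forall>b'\<in>B. b \<bullet> (C *v b') = (if b = b' then 1 else 0))"
  using \<open>k \<le> CARD('m)\<close>
proof (induction k)
  case 0
  show ?case by (intro exI[of _ "{}"]) simp
next
  case (Suc k)
  then obtain B where B: "finite B" "card B = k"
    and orth: "\<And>b b'. b \<in> B \<Longrightarrow> b' \<in> B \<Longrightarrow> b \<bullet> (C *v b') = (if b = b' then 1 else 0)"
    by auto
  have sym: "x \<bullet> (C *v y) = y \<bullet> (C *v x)" for x y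
    using assms(1) inner_matrix_vector_transpose[of x C y] by (simp add: spd_matrices_def inner_commute)
  have pos: "x \<noteq> 0 \<Longrightarrow> x \<bullet> (C *v x) > 0" for x
    using assms(1) by (simp add: spd_matrices_def)
  \<comment> \<open>Fewer vectors than the dimension cannot span, so there is a vector
    \<open>v\<close> to orthogonalize next.\<close>
  have "dim (span B) < DIM(real^'m)"
    using dim_le_card'[OF B(1)] B(2) Suc.prems by simp
  then have "span B \<noteq> UNIV"
    by (metis dim_UNIV less_irrefl)
  then obtain v where v: "v \<notin> span B" by auto
  \<comment> \<open>\<open>p\<close> is the projection of \<open>v\<close> onto
    \<open>span B\<close>, orthogonal with respect to \<open>C\<close>; the remainder
    \<open>w\<close> is nonzero because \<open>v\<close> lies outside the span.\<close>
  define p where "p = (\<Sum>b\<in>B. (b \<bullet> (C *v v)) *\<^sub>R b)"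
  define w where "w = v - p"
  have "p \<in> span B"
    unfolding p_def by (intro span_sum span_scale span_base)
  with v have "w \<noteq> 0" by (auto simp: w_def)
  have bw: "b \<bullet> (C *v w) = 0" if "b \<in> B" for b
  proof -
    have "b \<bullet> (C *v p) = p \<bullet> (C *v b)" by (rule sym)
    also have "\<dots> = (\<Sum>b'\<in>B. (b' \<bullet> (C *v v)) * (b' \<bullet> (C *v b)))"
      by (simp add: p_def inner_sum_left)
    also have "\<dots> = (\<Sum>b'\<in>B. if b' = b then b \<bullet> (C *v v) else 0)"
      using that by (intro sum.cong) (auto simp: orth)
    also have "\<dots> = b \<bullet> (C *v v)"
      using that B(1) by simp
    finally show ?thesis
      by (simp add: w_def matrix_vector_mult_diff_distrib inner_diff_right)
  qed
  define s where "s = sqrt (w \<bullet> (C *v w))"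
  have s: "s > 0" "s * s = w \<bullet> (C *v w)"
    using pos[OF \<open>w \<noteq> 0\<close>] by (simp_all add: s_def)
  define u where "u = (1 / s) *\<^sub>R w"
  have uu: "u \<bullet> (C *v u) = 1"
    using s by (simp add: u_def matrix_vector_mult_scaleR flip: s(2))
  have bu: "b \<bullet> (C *v u) = 0" "u \<bullet> (C *v b) = 0" if "b \<in> B" for b
    using bw[OF that] sym[of u b] by (simp_all add: u_def matrix_vector_mult_scaleR)
  \<comment> \<open>If \<open>u\<close> were in \<open>B\<close>, then \<open>bu\<close> would make
    its \<open>C\<close>-norm 0 instead of 1. Hence inserting \<open>u\<close> really raises the
    cardinality.\<close>
  have "u \<notin> B"
    using bu uu by force
  then show ?case
    using B orth uu bu by (intro exI[of _ "insert u B"]) auto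
qed

text \<open>A full \<open>C\<close>-orthonormal family, taken as the rows of \<open>P\<close>,
  satisfies \<open>P ** C ** transpose P = mat 1\<close>, so the inverse of \<open>P\<close> serves
  as \<open>L\<close>. Any such \<open>L\<close> will do for the substitution; it need not be
  triangular.\<close>

lemma spd_factorization:
  fixes C :: "real^'m^'m"
  assumes "C \<in> spd_matrices"
  obtains L where "C = L ** transpose L" "det L \<noteq> 0"
proof -
  obtain B where B: "finite B" "card B = CARD('m)"
    and orth: "\<And>b b'. b \<in> B \<Longrightarrow> b' \<in> B \<Longrightarrow> b \<bullet> (C *v b') = (if b = b' then 1 else 0)"
    using spd_orthonormal_subset[OF assms order_refl] by auto
  obtain f where f: "bij_betw f (UNIV :: 'm set) B"
    using finite_same_card_bij[of "UNIV :: 'm set" B] B by auto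
  define P :: "real^'m^'m" where "P = (\<chi> i. f i)"
  have "(P ** C ** transpose P) $ i $ j = f i \<bullet> (C *v f j)" for i j
    by (simp add: matrix_mul_assoc[symmetric]) (simp add: matrix_matrix_mult_def matrix_vector_mult_def inner_vec_def P_def transpose_def)
  moreover have "f i \<bullet> (C *v f j) = (if i = j then 1 else 0)" for i j
    using orth[of "f i" "f j"] f by (auto simp: bij_betw_def inj_on_eq_iff)
  ultimately have PCP: "P ** C ** transpose P = mat 1"
    by (simp add: vec_eq_iff mat_def)
  then have "det P * det C * det (transpose P) = 1"
    by (metis det_mul det_I)
  then have "invertible P"
    by (auto simp: invertible_det_nz)
  then obtain L where L: "P ** L = mat 1" "L ** P = mat 1"
    by (auto simp: invertible_def)
  then have "transpose P ** transpose L = mat 1"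
    by (metis matrix_transpose_mul transpose_mat)
  then have "C = (L ** P) ** C ** (transpose P ** transpose L)"
    by (simp add: L)
  also have "\<dots> = L ** (P ** C ** transpose P) ** transpose L"
    by (simp only: matrix_mul_assoc)
  finally have "C = L ** transpose L"
    by (simp add: PCP)
  moreover have "det L \<noteq> 0"
    using L by (metis det_mul det_I mult_zero_left zero_neq_one)
  ultimately show thesis by (rule that)
qed

text \<open>The inverse of \<open>L ** transpose L\<close> turns \<open>L\<close> into the inverse
  transpose of \<open>L\<close>, which the other factor \<open>L\<close> in the quadratic form
  cancels. So the substitution reduces the Gaussian exponent to the squared norm.\<close>

lemma matrix_inv_factorization:
  fixes L :: "real^'m^'m"
  assumes "det L \<noteq> 0"
  shows "matrix_inv (L ** transpose L) ** (L ** transpose L) = mat 1"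
    and "(L *v z) \<bullet> (matrix_inv (L ** transpose L) *v (L *v z)) = z \<bullet> z"
proof -
  let ?C = "L ** transpose L"
  have "invertible ?C"
    using assms by (simp add: invertible_det_nz det_mul)
  then have inv: "matrix_inv ?C ** ?C = mat 1"
    \<comment> \<open>\<open>matrix_inv\<close> is a Hilbert choice, so its defining equation has to
      be drawn from the existence of an inverse.\<close>
    unfolding matrix_inv_def invertible_def by (rule someI2_ex) simp
  then show "matrix_inv ?C ** ?C = mat 1" .
  have "invertible (transpose L)"
    using assms by (simp add: invertible_det_nz)
  then obtain K where K: "transpose L ** K = mat 1"
    by (auto simp: invertible_def)
  \<comment> \<open>Here \<open>L\<close> has been rewritten as \<open>?C ** K\<close>.\<close>
  have "matrix_inv ?C ** L = matrix_inv ?C ** ?C ** K"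
    by (simp add: K flip: matrix_mul_assoc)
  then have "matrix_inv ?C ** L = K"
    by (simp add: inv)
  then have "(L *v z) \<bullet> (matrix_inv ?C *v (L *v z)) = (L *v z) \<bullet> (K *v z)"
    by (simp add: matrix_vector_mul_assoc)
  also have "\<dots> = (transpose L *v (K *v z)) \<bullet> z"
    by (metis inner_commute inner_matrix_vector_transpose)
  also have "\<dots> = z \<bullet> z"
    by (simp only: matrix_vector_mul_assoc K matrix_vector_mul_lid)
  finally show "(L *v z) \<bullet> (matrix_inv ?C *v (L *v z)) = z \<bullet> z" .
qed

section \<open>Reduction to the standard Gaussian\<close>

text \<open>The product form is chosen so that Fubini applies directly;
  \<open>std_gaussian_eq\<close> links it to the closed form used in
  \<open>gaussian_density\<close>.\<close>

definition std_gaussian :: "real^'m \<Rightarrow> real" where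
  "std_gaussian z = (\<Prod>i\<in>UNIV. std_normal_density (z $ i))"

lemma std_gaussian_eq:
  fixes z :: "real^'m"
  shows "std_gaussian z = (2 * pi) powr (- (real CARD('m) / 2)) * exp (- (1/2) * (z \<bullet> z))"
proof -
  have "std_gaussian z = (1 / sqrt (2 * pi)) ^ CARD('m) * exp (\<Sum>i\<in>UNIV. - (z $ i)\<^sup>2 / 2)"
    by (simp add: std_gaussian_def std_normal_density_def exp_sum prod.distrib power_divide prod_dividef)
  also have "(1 / sqrt (2 * pi)) ^ CARD('m) = ((2 * pi) powr (- 1 / 2)) powr real CARD('m)"
    by (subst powr_realpow) (simp_all add: powr_minus_divide powr_half_sqrt)
  also have "\<dots> = (2 * pi) powr (- (real CARD('m) / 2))"
    by (simp add: powr_powr)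
  also have "(\<Sum>i\<in>UNIV. - (z $ i)\<^sup>2 / 2) = - (1/2) * (z \<bullet> z)"
    by (simp add: inner_vec_def sum_distrib_left power2_eq_square sum_negf sum_divide_distrib)
  finally show ?thesis .
qed

text \<open>The Jacobian \<open>\<bar>det L\<bar>\<close> cancels the factor
  \<open>det C powr (- (1/2))\<close> of the density, since \<open>det C\<close> is the square of
  \<open>det L\<close>.\<close>

lemma has_bochner_integral_gaussian_density:
  fixes L :: "real^'m^'m"
  assumes "det L \<noteq> 0" and [measurable]: "f \<in> borel_measurable borel"
    and int: "has_bochner_integral lborel (\<lambda>z. std_gaussian z * f (a + L *v z)) I"
  shows "has_bochner_integral lborel (\<lambda>x. gaussian_density a (L ** transpose L) x * f x) I"
proof (rule has_bochner_integral_lborel_affine_vec[OF assms(1)])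
  let ?C = "L ** transpose L"
  show "(\<lambda>x. gaussian_density a ?C x * f x) \<in> borel_measurable borel"
    unfolding gaussian_density_def by measurable
  have "det ?C powr (- (1/2)) = 1 / \<bar>det L\<bar>"
    using assms(1) by (simp add: det_mul powr_minus_divide powr_half_sqrt real_sqrt_abs2)
  then have "\<bar>det L\<bar> * gaussian_density a ?C (a + L *v z) = std_gaussian z" for z
    using assms(1) by (simp add: gaussian_density_def std_gaussian_eq matrix_inv_factorization)
  then show "has_bochner_integral lborel (\<lambda>z. \<bar>det L\<bar> * (gaussian_density a ?C (a + L *v z) * f (a + L *v z))) I"
    using int by (simp add: mult.assoc[symmetric])
qed

section \<open>Moments of the standard Gaussian\<close>

lemma std_normal_moment_0: "has_bochner_integral lborel std_normal_density 1"
  using std_normal_moment_even[of 0] by simp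

lemma std_normal_moment_1: "has_bochner_integral lborel (\<lambda>x. std_normal_density x * x) 0"
  using std_normal_moment_odd[of 0] by simp

lemma std_normal_moment_2: "has_bochner_integral lborel (\<lambda>x. std_normal_density x * (x * x)) 1"
  using std_normal_moment_even[of 1] by (simp add: power2_eq_square fact_numeral)

text \<open>Completing the square: the exponential weight moves the mean from 0 to \<open>b\<close>
  and leaves the constant factor \<open>exp (b\<^sup>2 / 2)\<close>.\<close>

lemma std_normal_exp:
  "has_bochner_integral lborel (\<lambda>x. std_normal_density x * exp (b * x)) (exp (b\<^sup>2 / 2))"
proof -
  have "std_normal_density x * exp (b * x) = exp (b\<^sup>2 / 2) * normal_density b 1 x" for x
    by (simp add: normal_density_def field_simps power2_eq_square flip: exp_add)
  moreover have "has_bochner_integral lborel (normal_density b 1) 1"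
    by (simp add: has_bochner_integral_iff)
  then have "has_bochner_integral lborel (\<lambda>x. exp (b\<^sup>2 / 2) * normal_density b 1 x) (exp (b\<^sup>2 / 2) * 1)"
    by (intro has_bochner_integral_mult_right)
  ultimately show ?thesis by simp
qed

lemma std_gaussian_moment_0: "has_bochner_integral lborel (std_gaussian :: real^'m \<Rightarrow> real) 1"
  using has_bochner_integral_lborel_vec_prod[of "\<lambda>_::'m. std_normal_density", OF std_normal_moment_0]
  by (simp add: std_gaussian_def[abs_def])

lemma std_gaussian_moment_1:
  "has_bochner_integral lborel (\<lambda>z::real^'m. std_gaussian z * z $ k) 0"
proof -
  \<comment> \<open>The factor \<open>z $ k\<close> is spread over a product by letting every other
    coordinate contribute 1; the vanishing first moment at \<open>k\<close> then annihilates the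
    product of the integrals.\<close>
  have "has_bochner_integral lborel (\<lambda>x. std_normal_density x * (if i = k then x else 1)) (if i = k then 0 else 1)"
    for i using std_normal_moment_0 std_normal_moment_1 by simp
  from has_bochner_integral_lborel_vec_prod[OF this]
  have "has_bochner_integral lborel (\<lambda>z::real^'m. \<Prod>i\<in>UNIV. std_normal_density (z $ i) * (if i = k then z $ i else 1))
      (\<Prod>i\<in>UNIV. if i = k then 0 else 1)" .
  then show ?thesis
    by (simp add: prod.distrib std_gaussian_def)
qed

lemma std_gaussian_moment_2:
  "has_bochner_integral lborel (\<lambda>z::real^'m. std_gaussian z * (z $ k * z $ l)) (if k = l then 1 else 0)"
proof -
  \<comment> \<open>Coordinate \<open>i\<close> contributes its second moment 1 if it equals both
    \<open>k\<close> and \<open>l\<close>, its first moment 0 if it equals just one of them, and the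
    total mass 1 otherwise.\<close>
  have "has_bochner_integral lborel
      (\<lambda>x. std_normal_density x * ((if i = k then x else 1) * (if i = l then x else 1)))
      (if i = k then if k = l then 1 else 0 else if i = l then 0 else 1)"
    for i using std_normal_moment_0 std_normal_moment_1 std_normal_moment_2 by simp
  from has_bochner_integral_lborel_vec_prod[OF this]
  have "has_bochner_integral lborel
      (\<lambda>z::real^'m. \<Prod>i\<in>UNIV. std_normal_density (z $ i) * ((if i = k then z $ i else 1) * (if i = l then z $ i else 1)))
      (\<Prod>i\<in>UNIV. if i = k then if k = l then 1 else 0 else if i = l then 0 else 1)" .
  moreover have "(\<Prod>i\<in>UNIV. if i = k then if k = l then 1 else 0 else if i = l then 0 else 1) = (if k = l then 1 else 0 :: real)"
    by (cases "k = l") (auto intro!: prod.neutral prod_zero)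
  ultimately show ?thesis
    by (simp add: prod.distrib std_gaussian_def)
qed

lemma std_gaussian_linear:
  "has_bochner_integral lborel (\<lambda>z::real^'m. std_gaussian z * (b \<bullet> z)) 0"
proof -
  have "has_bochner_integral lborel (\<lambda>z::real^'m. \<Sum>i\<in>UNIV. b $ i * (std_gaussian z * z $ i)) (\<Sum>i\<in>UNIV. b $ i * 0)"
    by (intro has_bochner_integral_sum has_bochner_integral_mult_right std_gaussian_moment_1)
  then show ?thesis
    by (simp add: inner_vec_def sum_distrib_left mult.left_commute)
qed

text \<open>Distinct coordinates are uncorrelated and each has variance 1, so only the diagonal
  entries of \<open>D\<close> survive.\<close>

lemma std_gaussian_quadratic:
  fixes D :: "real^'m^'m"
  shows "has_bochner_integral lborel (\<lambda>z. std_gaussian z * (z \<bullet> (D *v z))) (trace D)"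
proof -
  have "has_bochner_integral lborel
      (\<lambda>z::real^'m. \<Sum>i\<in>UNIV. \<Sum>j\<in>UNIV. D $ i $ j * (std_gaussian z * (z $ i * z $ j)))
      (\<Sum>i\<in>UNIV. \<Sum>j\<in>UNIV. D $ i $ j * (if i = j then 1 else 0))"
    by (intro has_bochner_integral_sum has_bochner_integral_mult_right std_gaussian_moment_2)
  moreover have "(\<Sum>i\<in>UNIV. \<Sum>j\<in>UNIV. D $ i $ j * (if i = j then 1 else 0)) = trace D"
    by (simp add: trace_def if_distrib cong: if_cong)
  moreover have "(\<Sum>i\<in>UNIV. \<Sum>j\<in>UNIV. D $ i $ j * (std_gaussian z * (z $ i * z $ j))) = std_gaussian z * (z \<bullet> (D *v z))" for z
    by (simp add: inner_vec_def matrix_vector_mult_def sum_distrib_left mult_ac)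
  ultimately show ?thesis by simp
qed

lemma std_gaussian_exp:
  "has_bochner_integral lborel (\<lambda>z::real^'m. std_gaussian z * exp (b \<bullet> z)) (exp ((b \<bullet> b) / 2))"
proof -
  have "has_bochner_integral lborel (\<lambda>z::real^'m. \<Prod>i\<in>UNIV. std_normal_density (z $ i) * exp (b $ i * z $ i))
      (\<Prod>i\<in>UNIV. exp ((b $ i)\<^sup>2 / 2))"
    by (rule has_bochner_integral_lborel_vec_prod[OF std_normal_exp])
  then show ?thesis
    by (simp add: std_gaussian_def prod.distrib inner_vec_def exp_sum sum_divide_distrib power2_eq_square)
qed

section \<open>The logarithm of the density ratio\<close>

lemma spd_det_pos:
  fixes C :: "real^'m^'m"
  assumes "C \<in> spd_matrices"
  shows "det C > 0"
proof -
  obtain L where "C = L ** transpose L" "det L \<noteq> 0"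
    using assms by (rule spd_factorization)
  then show ?thesis
    by (auto simp: det_mul zero_less_mult_iff)
qed

lemma ln_gaussian_density:
  fixes C :: "real^'m^'m"
  assumes "det C > 0"
  shows "ln (gaussian_density a C x) = - (real CARD('m) / 2) * ln (2 * pi) - (1/2) * ln (det C)
    - (1/2) * ((x - a) \<bullet> (matrix_inv C *v (x - a)))"
  using assms by (simp add: gaussian_density_def ln_mult ln_powr)

lemma ln_joint_density:
  fixes C :: "real^'m^'m"
  assumes "det C > 0"
  shows "ln (joint_density A \<mu> C x y) = - (real CARD('m) / 2) * ln (2 * pi) - (1/2) * ln (det C)
    + (A *v x) \<bullet> vec_real y - vec_exp (A *v x) \<bullet> 1 - vec_ln (vec_fact y) \<bullet> 1
    - (1/2) * ((x - \<mu>) \<bullet> (matrix_inv C *v (x - \<mu>)))"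
  using assms by (simp add: joint_density_def ln_mult ln_powr)

text \<open>Both densities are positive, so the logarithm of the quotient splits; the powers of
  \<open>2 * pi\<close> cancel because both densities carry the same one.\<close>

lemma F_integrand_eq:
  fixes A :: "real^'m^'n"
  assumes "det C > 0" "det C0 > 0"
  shows "F_integrand A y \<mu> C0 a C x = gaussian_density a C x *
    ((A *v x) \<bullet> vec_real y - vec_exp (A *v x) \<bullet> 1 - vec_ln (vec_fact y) \<bullet> 1
     + (1/2) * ln (det C) - (1/2) * ln (det C0)
     - (1/2) * ((x - \<mu>) \<bullet> (matrix_inv C0 *v (x - \<mu>)))
     + (1/2) * ((x - a) \<bullet> (matrix_inv C *v (x - a))))"
proof -
  have "gaussian_density a C x > 0" "joint_density A \<mu> C0 x y > 0"
    using assms by (simp_all add: gaussian_density_def joint_density_def)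
  then show ?thesis
    using assms by (simp add: F_integrand_def ln_div ln_gaussian_density ln_joint_density)
qed

section \<open>Gaussian expectations of the terms of the logarithm\<close>

text \<open>After expansion the cross terms are linear in \<open>z\<close> and integrate to 0, while
  the pure quadratic term gives a trace that is cyclic. This serves both the prior (shift
  \<open>xbar - \<mu>0\<close>) and the entropy (shift 0).\<close>

lemma std_gaussian_shifted_quadratic:
  fixes L :: "real^'m^'m"
  shows "has_bochner_integral lborel
    (\<lambda>z. std_gaussian z * ((u + L *v z) \<bullet> (D *v (u + L *v z))))
    (u \<bullet> (D *v u) + trace (D ** (L ** transpose L)))"
proof -
  \<comment> \<open>\<open>D\<close> is an arbitrary matrix here, so the two cross terms differ and
    contribute \<open>transpose D\<close> and \<open>D\<close> separately.\<close>
  define b where "b = transpose L *v (transpose D *v u + D *v u)"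
  have eq: "(u + L *v z) \<bullet> (D *v (u + L *v z))
      = u \<bullet> (D *v u) + b \<bullet> z + z \<bullet> ((transpose L ** D ** L) *v z)" for z
  proof -
    have "(L *v z) \<bullet> (D *v (L *v z)) = z \<bullet> ((transpose L ** D ** L) *v z)"
      using inner_matrix_vector_transpose[of z "transpose L" "D *v (L *v z)"]
      by (simp flip: matrix_vector_mul_assoc del: transpose_matrix_vector)
    moreover have "u \<bullet> (D *v (L *v z)) + (L *v z) \<bullet> (D *v u) = b \<bullet> z"
      by (simp add: b_def inner_matrix_vector_transpose[of u D] inner_commute[of "L *v z"]
          inner_matrix_vector_transpose[of _ L] matrix_vector_right_distrib inner_add_left)
    ultimately show ?thesis
      by (simp add: matrix_vector_right_distrib inner_add_left inner_add_right)
  qed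
  have tr: "trace (transpose L ** D ** L) = trace (D ** (L ** transpose L))"
    by (metis matrix_mul_assoc trace_mul_sym)
  have "has_bochner_integral lborel
    (\<lambda>z. std_gaussian z * (u \<bullet> (D *v u)) + std_gaussian z * (b \<bullet> z)
       + std_gaussian z * (z \<bullet> ((transpose L ** D ** L) *v z)))
    (1 * (u \<bullet> (D *v u)) + 0 + trace (transpose L ** D ** L))"
    by (intro has_bochner_integral_add has_bochner_integral_mult_left std_gaussian_moment_0
        std_gaussian_linear std_gaussian_quadratic)
  then show ?thesis
    by (simp add: eq tr distrib_left)
qed

lemma std_gaussian_vec_exp:
  fixes A :: "real^'m^'n" and L :: "real^'m^'m"
  shows "has_bochner_integral lborel
    (\<lambda>z. std_gaussian z * (vec_exp (A *v (a + L *v z)) \<bullet> 1))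
    (1 \<bullet> vec_exp (A *v a + (1/2) *\<^sub>R diag_vec (A ** (L ** transpose L) ** transpose A)))"
proof -
  have row: "(A *v (a + L *v z)) $ i = (A *v a) $ i + (A ** L) $ i \<bullet> z" for z i
    by (simp add: matrix_vector_right_distrib matrix_vector_mul_assoc matrix_vector_mul_component)
  \<comment> \<open>In this form the diagonal entries are visibly the squared norms of the rows of
    \<open>A ** L\<close>.\<close>
  have "A ** (L ** transpose L) ** transpose A = (A ** L) ** transpose (A ** L)"
    by (simp add: matrix_transpose_mul matrix_mul_assoc)
  then have diag: "diag_vec (A ** (L ** transpose L) ** transpose A) $ i = (A ** L) $ i \<bullet> (A ** L) $ i" for i
    by (simp add: diag_vec_def inner_vec_def) (simp add: matrix_matrix_mult_def[of "A ** L"] transpose_def)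
  have "has_bochner_integral lborel
    (\<lambda>z. \<Sum>i\<in>UNIV. exp ((A *v a) $ i) * (std_gaussian z * exp ((A ** L) $ i \<bullet> z)))
    (\<Sum>i\<in>UNIV. exp ((A *v a) $ i) * exp (((A ** L) $ i \<bullet> (A ** L) $ i) / 2))"
    by (intro has_bochner_integral_sum has_bochner_integral_mult_right std_gaussian_exp)
  then show ?thesis
    by (simp add: inner_vec_def[of _ 1] inner_vec_def[of 1] vec_exp_def row diag exp_add sum_distrib_left mult.left_commute)
qed

section \<open>The closed form of the functional\<close>

theorem proposition3p1:
  fixes A :: "real^'m^'n" and y :: "nat^'n"
    and \<mu>0 :: "real^'m" and C0 :: "real^'m^'m"
    and xbar :: "real^'m" and C :: "real^'m^'m"
  assumes "C0 \<in> spd_matrices" and "C \<in> spd_matrices"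
  shows "integrable lborel (F_integrand A y \<mu>0 C0 xbar C) \<and>
    F_functional A y \<mu>0 C0 xbar C =
      vec_real y \<bullet> (A *v xbar)
      - 1 \<bullet> vec_exp (A *v xbar + (1/2) *\<^sub>R diag_vec (A ** C ** transpose A))
      - (1/2) * ((xbar - \<mu>0) \<bullet> (matrix_inv C0 *v (xbar - \<mu>0)))
      - (1/2) * trace (matrix_inv C0 ** C)
      + (1/2) * ln (det C)
      - (1/2) * ln (det C0)
      + real CARD('m) / 2
      - 1 \<bullet> vec_ln (vec_fact y)"
proof -
  obtain L where L: "C = L ** transpose L" "det L \<noteq> 0"
    using assms(2) by (rule spd_factorization)
  have det: "det C > 0" "det C0 > 0"
    using assms by (auto intro: spd_det_pos)
  have [measurable]: "vec_exp \<in> borel_measurable borel"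
    unfolding vec_exp_def[abs_def]
    by (intro borel_measurable_continuous_onI continuous_intros)
  define D Q where "D = matrix_inv C0" and "Q = matrix_inv C"
  \<comment> \<open>\<open>c\<close> collects the terms of the logarithm that are independent of
    \<open>x\<close>; \<open>g\<close> below is the whole logarithm of the density ratio.\<close>
  define c where "c = (1/2) * ln (det C) - (1/2) * ln (det C0) - 1 \<bullet> vec_ln (vec_fact y)"
  define u where "u = xbar - \<mu>0"
  define g where "g x = (A *v x) \<bullet> vec_real y - vec_exp (A *v x) \<bullet> 1 + c
     - (1/2) * ((x - \<mu>0) \<bullet> (D *v (x - \<mu>0))) + (1/2) * ((x - xbar) \<bullet> (Q *v (x - xbar)))" for x
  let ?b = "transpose L *v (transpose A *v vec_real y)"
  have lin: "(A *v (xbar + L *v z)) \<bullet> vec_real y = vec_real y \<bullet> (A *v xbar) + ?b \<bullet> z" for z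
    by (simp add: inner_commute[of _ "vec_real y"] matrix_vector_right_distrib inner_add_right
        inner_matrix_vector_transpose[of "vec_real y" A "L *v z"] inner_matrix_vector_transpose[of _ L])
  \<comment> \<open>Each summand now matches one expectation rule. The last one is written with
    \<open>0 + L *v z\<close> so that the rule for shifted quadratics applies with shift 0.\<close>
  have g: "std_gaussian z * g (xbar + L *v z) =
      std_gaussian z * (vec_real y \<bullet> (A *v xbar) + c) + std_gaussian z * (?b \<bullet> z)
      - std_gaussian z * (vec_exp (A *v (xbar + L *v z)) \<bullet> 1)
      - (1/2) * (std_gaussian z * ((u + L *v z) \<bullet> (D *v (u + L *v z))))
      + (1/2) * (std_gaussian z * ((0 + L *v z) \<bullet> (Q *v (0 + L *v z))))" for z
    by (simp add: g_def lin u_def algebra_simps(1-5) ring_distribs diff_add_eq add_diff_eq)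
  \<comment> \<open>The value is left unsimplified, with \<open>1 *\<close>, \<open>+ 0\<close> and
    \<open>0 \<bullet> (Q *v 0)\<close>, to unify with the results of the rules.\<close>
  have "has_bochner_integral lborel (\<lambda>z. std_gaussian z * g (xbar + L *v z))
    (1 * (vec_real y \<bullet> (A *v xbar) + c) + 0
     - 1 \<bullet> vec_exp (A *v xbar + (1/2) *\<^sub>R diag_vec (A ** C ** transpose A))
     - (1/2) * (u \<bullet> (D *v u) + trace (D ** C)) + (1/2) * (0 \<bullet> (Q *v 0) + trace (Q ** C)))"
    unfolding g L(1)
    by (intro has_bochner_integral_add has_bochner_integral_diff has_bochner_integral_mult_left
        has_bochner_integral_mult_right std_gaussian_moment_0 std_gaussian_linear
        std_gaussian_vec_exp std_gaussian_shifted_quadratic)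
  \<comment> \<open>The entropy term of \<open>q\<close> yields the trace of the identity, the
    source of the summand \<open>real CARD('m) / 2\<close>.\<close>
  moreover have "trace (Q ** C) = real CARD('m)"
    using L by (simp add: Q_def matrix_inv_factorization trace_I)
  moreover have "g \<in> borel_measurable borel"
    unfolding g_def by measurable
  ultimately have "has_bochner_integral lborel (\<lambda>x. gaussian_density xbar C x * g x)
    (vec_real y \<bullet> (A *v xbar) + c
     - 1 \<bullet> vec_exp (A *v xbar + (1/2) *\<^sub>R diag_vec (A ** C ** transpose A))
     - (1/2) * (u \<bullet> (D *v u) + trace (D ** C)) + real CARD('m) / 2)"
    using has_bochner_integral_gaussian_density[OF L(2), of g xbar] by (simp add: L(1))
  moreover have "(\<lambda>x. gaussian_density xbar C x * g x) = F_integrand A y \<mu>0 C0 xbar C"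
    by (rule ext, subst F_integrand_eq[OF det])
      (simp add: g_def D_def Q_def c_def inner_commute[of 1])
  \<comment> \<open>\<open>has_bochner_integral\<close> delivers integrability along with the value.
    The former matters because a non-integrable function has integral 0 by convention.\<close>
  ultimately show ?thesis
    unfolding F_functional_def
    by (simp add: has_bochner_integral_iff c_def u_def D_def algebra_simps)
qed

end
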